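(* Let $N\in\mathbb{N}$, let $I$ be a non-empty set, let $\mathfrak{d}=(\mathfrak{d}_1,\ldots,\mathfrak{d}_N)\colon I\to\mathbb{N}^N$ be an $N$-fold dimension mapping on $I$, let $c,T,r_0,r_1,\ldots,r_N,\iota_1,\ldots,\iota_N\in[0,\infty)$, $H=(H_{i,\varepsilon})_{(i,\varepsilon)\in I\times(0,1]}\subseteq(0,\infty]$, $\mathcal{G}=(\mathcal{G}_{i,n,\varepsilon})_{(i,n,\varepsilon)\in I\times\mathbb{N}\times(0,1]}\subseteq(0,\infty]$, $\mathcal{H}=(\mathcal{H}_{i,n,\varepsilon})_{(i,n,\varepsilon)\in I\times\mathbb{N}\times(0,1]}\subseteq(0,\infty]$, $a\in C(\mathbb{R},\mathbb{R})$ satisfy for all $i\in I$, $n\in\mathbb{N}$, $\varepsilon\in(0,1]$ that $\mathcal{G}_{i,n,\varepsilon}=1+\frac{cT}{n}$ and $\mathcal{H}_{i,n,\varepsilon}=H_{i,\frac{\varepsilon}{\max\{T,1\}}}$. Let $\mathfrak{w}\colon[0,\infty)\to[0,\infty)$ and $\mathfrak{I}\colon I\to\mathbb{N}$ be functions, let $f=(f_i)_{i\in I}\in\mathcal{W}_{a,\mathfrak{w},c,H}^{r_0,r_1,\ldots,r_N}(I,\mathfrak{d})$ satisfy for all $i\in I$ that $f_i\in C(\mathbb{R}^{\mathfrak{I}(i)},\mathbb{R}^{\mathfrak{I}(i)})$, let $\mathcal{E}^{(n)}=(\mathcal{E}_i^{(n)})_{i\in I}$, $n\in\mathbb{N}$,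 be function families on $I$ with $\mathcal{E}_i^{(n)}\in C(\mathbb{R}^{\mathfrak{I}(i)},\mathbb{R}^{\mathfrak{I}(i)})$ for all $n\in\mathbb{N}$, $i\in I$, assume for all $i\in I$, $n\in\mathbb{N}$, $x,y\in\mathbb{R}^{\mathfrak{I}(i)}$ that $$\mathfrak{I}(i)\le c\prod_{l=1}^N|\mathfrak{d}_l(i)|^{\iota_l},\qquad\mathcal{E}_i^{(n)}(x)=x+\tfrac{T}{n}f_i(x),\qquad\text{and}\qquad\|f_i(x)-f_i(y)\|\le c\|x-y\|,$$ and let $(\mathfrak{i}_d)_{d\in\mathbb{N}}\subseteq\mathbb{N}$, $(\Psi_d)_{d\in\mathbb{N}}\subseteq\mathscr{N}$ satisfy for all $d\in\mathbb{N}$ that $\mathcal{R}_a(\Psi_d)=\mathrm{id}_{\mathbb{R}^d}$, $\mathcal{D}(\Psi_d)=(d,\mathfrak{i}_d,d)$, and $\mathfrak{i}_d\le cd$. Then $$\Big(I\times\mathbb{N}\ni(i,n)\mapsto\mathcal{E}_i^{(n)}\in C(\mathbb{R}^{\mathfrak{I}(i)},\mathbb{R}^{\mathfrak{I}(i)})\Big)\in\mathcal{W}_{a,\mathfrak{w},\mathcal{G},\mathcal{H}}^{r_0,\,r_1+4\iota_1,\ldots,\,r_N+4\iota_N,\,0}(I\times\mathbb{N},\mathfrak{d}\otimes\mathrm{id}_{\mathbb{N}}).$$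
   Context: $\mathbb{N}=\{1,2,3,\ldots\}$ and $\|\cdot\|$ is the Euclidean norm on every $\mathbb{R}^d$. ANNs: $\mathscr{N} = \bigcup_{L\in\mathbb{N}}\bigcup_{l_0,\ldots,l_L\in\mathbb{N}} \left(\times_{k=1}^L (\mathbb{R}^{l_k\times l_{k-1}}\times\mathbb{R}^{l_k})\right)$. For $\Phi=((W_1,B_1),\ldots,(W_L,B_L)) \in \times_{k=1}^L (\mathbb{R}^{l_k\times l_{k-1}}\times\mathbb{R}^{l_k})$: $\mathcal{D}(\Phi)=(l_0,l_1,\ldots,l_L)$, $\mathcal{P}(\Phi)=\sum_{k=1}^L l_k(l_{k-1}+1)$, and for $a\in C(\mathbb{R},\mathbb{R})$ the realization $\mathcal{R}_a(\Phi)\in C(\mathbb{R}^{l_0},\mathbb{R}^{l_L})$ is $(\mathcal{R}_a(\Phi))(x_0)=W_Lx_{L-1}+B_L$, where for $0<k<L$ the vector $x_k$ is obtained by applying $a$ componentwise to $W_kx_{k-1}+B_k$. A function family on a non-empty set $I$ is a map $f=(f_i)_{i\in I}\colon I\to\bigcup_{k,l\in\mathbb{N}}C(\mathbb{R}^k,\mathbb{R}^l)$. An $N$-fold dimension mapping on $I$ is a function $\mathfrak{d}=(\mathfrak{d}_1,\ldots,\mathfrak{d}_N)\colon I\to\mathbb{N}^N$. The $(N+1)$-fold dimension mapping $\mathfrak{d}\otimes\mathrm{id}_{\mathbb{N}}$ on $I\times\mathbb{N}$ is $(\mathfrak{d}\otimes\mathrm{id}_{\mathbb{N}})(i,n)=(\mathfrak{d}_1(i),\ldots,\mathfrak{d}_N(i),n)$.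 Approximation spaces: for an $N$-fold dimension mapping $\mathfrak{d}$ on $I$, $r_0,\ldots,r_N\in\mathbb{R}$, $a\in C(\mathbb{R},\mathbb{R})$, $G=(G_{i,\varepsilon})_{(i,\varepsilon)\in I\times(0,1]}\subseteq(0,\infty]$, $H=(H_{i,\varepsilon})_{(i,\varepsilon)\in I\times(0,1]}\subseteq(0,\infty]$, and $\mathfrak{w}\colon[0,\infty)\to[0,\infty)$, the set $\mathcal{W}_{a,\mathfrak{w},G,H}^{r_0,r_1,\ldots,r_N}(I,\mathfrak{d})$ consists of all function families $f=(f_i)_{i\in I}$ on $I$ for which there exists $K\in\mathbb{R}$ such that for all $i\in I$, $\varepsilon\in(0,1]$ there exist $\Phi\in\mathscr{N}$ and $m,n\in\mathbb{N}$ such that for all $x\in\mathbb{R}^m$: $\{f_i,\mathcal{R}_a(\Phi)\}\subseteq C(\mathbb{R}^m,\mathbb{R}^n)$, $\mathcal{P}(\Phi)\le K\varepsilon^{-r_0}\prod_{l=1}^N|\mathfrak{d}_l(i)|^{r_l}$, $\mathfrak{w}(\|x\|)\|f_i(x)-(\mathcal{R}_a(\Phi))(x)\|\le\varepsilon$, and $\|(\mathcal{R}_a(\Phi))(x)\|\le G_{i,\varepsilon}(H_{i,\varepsilon}+\|x\|)$. A constant $c$ in place of $G$ means $G_{i,\varepsilon}=c$ for all $i,\varepsilon$ (in the claim $1\le\mathfrak{i}_1\le c$, so $c>0$). *)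

theory Defs
  imports "Jordan_Normal_Form.Matrix" "HOL-Library.Extended_Real" Complex_Main
begin

definition eucl_norm :: "real vec \<Rightarrow> real" where
  "eucl_norm x = sqrt (x \<bullet> x)"

text \<open>
  The space \<open>\<real>\<^sup>k\<close> is \<^term>\<open>carrier_vec k :: real vec set\<close>.  A function on \<open>\<real>\<^sup>k\<close> is encoded as
  a total function with the value \<^term>\<open>0\<^sub>v 0 :: real vec\<close> outside \<open>\<real>\<^sup>k\<close>.  As target dimensions are
  positive, this dummy value is never a proper value, so (as for set-theoretic functions) the
  encoded function determines its domain; see \<open>cont_maps_dims_unique\<close> below.
\<close>

definition restrict_dim :: "nat \<Rightarrow> (real vec \<Rightarrow> real vec) \<Rightarrow> real vec \<Rightarrow> real vec" where
  "restrict_dim k g = (\<lambda>x. if x \<in> carrier_vec k then g x else 0\<^sub>v 0)"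

definition cont_maps :: "nat \<Rightarrow> nat \<Rightarrow> (real vec \<Rightarrow> real vec) set" where
  "cont_maps k l = {g.
     (\<forall>x\<in>carrier_vec k. g x \<in> carrier_vec l) \<and>
     (\<forall>x. x \<notin> carrier_vec k \<longrightarrow> g x = 0\<^sub>v 0) \<and>
     (\<forall>x\<in>carrier_vec k. \<forall>e>0. \<exists>\<delta>>0. \<forall>y\<in>carrier_vec k.
        eucl_norm (y - x) < \<delta> \<longrightarrow> eucl_norm (g y - g x) < e)}"

lemma cont_maps_dims_unique:
  assumes "g \<in> cont_maps k l" "g \<in> cont_maps k' l'" "l \<ge> 1" "l' \<ge> 1"
  shows "k = k' \<and> l = l'"
proof -
  have 1: "g (0\<^sub>v k) \<in> carrier_vec l" using assms(1) by (simp add: cont_maps_def)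
  have "g (0\<^sub>v k) \<noteq> 0\<^sub>v 0"
  proof
    assume "g (0\<^sub>v k) = 0\<^sub>v 0"
    with 1 have "dim_vec (0\<^sub>v 0 :: real vec) = l" by (metis carrier_vecD)
    with assms(3) show False by simp
  qed
  then have "0\<^sub>v k \<in> (carrier_vec k' :: real vec set)"
    using assms(2) unfolding cont_maps_def by blast
  then have k: "k = k'" by (metis carrier_vecD index_zero_vec(2))
  then have "g (0\<^sub>v k) \<in> carrier_vec l'" using assms(2) by (simp add: cont_maps_def)
  with 1 k show ?thesis by (metis carrier_vecD)
qed

text \<open>The list entry with index \<open>k\<close> holds the weights and biases \<open>(W\<^sub>k\<^sub>+\<^sub>1, B\<^sub>k\<^sub>+\<^sub>1)\<close>.\<close>

type_synonym ann = "(real mat \<times> real vec) list"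

definition ANN :: "ann set" where
  "ANN = {\<Phi>. \<exists>L l. L \<ge> 1 \<and> (\<forall>k\<le>L. (l k :: nat) \<ge> 1) \<and> length \<Phi> = L \<and>
     (\<forall>k<L. \<Phi> ! k \<in> carrier_mat (l (Suc k)) (l k) \<times> carrier_vec (l (Suc k)))}"

definition ann_dims :: "ann \<Rightarrow> nat list" where
  "ann_dims \<Phi> = dim_col (fst (hd \<Phi>)) # map (\<lambda>(W, B). dim_row W) \<Phi>"

definition ann_params :: "ann \<Rightarrow> nat" where
  "ann_params \<Phi> = (\<Sum>(W, B)\<leftarrow>\<Phi>. dim_row W * (dim_col W + 1))"

fun ann_eval :: "(real \<Rightarrow> real) \<Rightarrow> ann \<Rightarrow> real vec \<Rightarrow> real vec" where
  "ann_eval a [] x = x"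
| "ann_eval a [(W, B)] x = W *\<^sub>v x + B"
| "ann_eval a ((W, B) # V # \<Phi>) x = ann_eval a (V # \<Phi>) (map_vec a (W *\<^sub>v x + B))"

definition realization :: "(real \<Rightarrow> real) \<Rightarrow> ann \<Rightarrow> real vec \<Rightarrow> real vec" where
  "realization a \<Phi> = restrict_dim (hd (ann_dims \<Phi>)) (ann_eval a \<Phi>)"

definition function_family :: "'i set \<Rightarrow> ('i \<Rightarrow> real vec \<Rightarrow> real vec) \<Rightarrow> bool" where
  "function_family I f \<longleftrightarrow> (\<forall>i\<in>I. \<exists>k\<ge>1. \<exists>l\<ge>1. f i \<in> cont_maps k l)"

text \<open>The component \<open>\<dd>\<^sub>l(i)\<close>, \<open>l \<in> {1..N}\<close>, is \<^term>\<open>\<dd> i l\<close>; other values of \<^term>\<open>l\<close> are irrelevant.\<close>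

definition dim_mapping :: "nat \<Rightarrow> 'i set \<Rightarrow> ('i \<Rightarrow> nat \<Rightarrow> nat) \<Rightarrow> bool" where
  "dim_mapping N I \<dd> \<longleftrightarrow> (\<forall>i\<in>I. \<forall>l\<in>{1..N}. \<dd> i l \<ge> 1)"

definition dim_tensor_id :: "nat \<Rightarrow> ('i \<Rightarrow> nat \<Rightarrow> nat) \<Rightarrow> 'i \<times> nat \<Rightarrow> nat \<Rightarrow> nat" where
  "dim_tensor_id N \<dd> = (\<lambda>(i, n) l. if l \<le> N then \<dd> i l else n)"

text \<open>The exponents \<open>r\<^sub>0, \<dots>, r\<^sub>N\<close> are the values of \<^term>\<open>r\<close> on \<open>{0..N}\<close>.\<close>

definition approx_space ::
  "(real \<Rightarrow> real) \<Rightarrow> (real \<Rightarrow> real) \<Rightarrow> ('i \<Rightarrow> real \<Rightarrow> ereal) \<Rightarrow> ('i \<Rightarrow> real \<Rightarrow> ereal) \<Rightarrow>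
   nat \<Rightarrow> (nat \<Rightarrow> real) \<Rightarrow> 'i set \<Rightarrow> ('i \<Rightarrow> nat \<Rightarrow> nat) \<Rightarrow> ('i \<Rightarrow> real vec \<Rightarrow> real vec) set" where
  "approx_space a w G H N r I \<dd> = {f. function_family I f \<and>
     (\<exists>K. \<forall>i\<in>I. \<forall>\<epsilon>\<in>{0<..1}. \<exists>\<Phi>\<in>ANN. \<exists>m\<ge>1. \<exists>n\<ge>1. \<forall>x\<in>carrier_vec m.
        {f i, realization a \<Phi>} \<subseteq> cont_maps m n \<and>
        real (ann_params \<Phi>) \<le> K * \<epsilon> powr (- r 0) * (\<Prod>l=1..N. real (\<dd> i l) powr r l) \<and>
        w (eucl_norm x) * eucl_norm (f i x - realization a \<Phi> x) \<le> \<epsilon> \<and>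
        ereal (eucl_norm (realization a \<Phi> x)) \<le> G i \<epsilon> * (H i \<epsilon> + ereal (eucl_norm x)))}"

end

theory Submission
  imports Defs "HOL-Analysis.L2_Norm"
begin

text \<open>
  If \<open>\<Phi>\<close> approximates \<open>f i\<close> up to \<open>\<epsilon> / max T 1\<close>, then \<open>x \<mapsto> x + (T/n) R(\<Phi>)(x)\<close> approximates the Euler
  step up to \<open>\<epsilon>\<close>.  This map is itself realized by a network: if \<open>\<Phi>\<close> has a single layer, the map
  is affine; otherwise run in parallel to \<open>\<Phi>\<close> an identity network of the same depth, obtained by
  composing \<open>\<Psi> d\<close> with itself, and add the two outputs in the last layer.  Every hidden layer grows
  by \<open>\<ii> d\<close> neurons, which costs at most a factor \<open>(1 + \<ii> d)\<^sup>2 \<le> (2 c d)\<^sup>2\<close> in parameters.  The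
  dimension \<open>d = \<II> i\<close> is at most \<open>c \<Prod> \<dd>\<^sub>l(i)\<^bsup>\<iota>\<^sub>l\<^esup>\<close>, so this factor is polynomial in \<open>\<dd>(i)\<close> and
  independent of \<open>n\<close>.
\<close>

section \<open>Euclidean norm\<close>

lemma eucl_norm_L2_set: "eucl_norm x = L2_set (($) x) {0..<dim_vec x}"
  by (simp add: eucl_norm_def L2_set_def scalar_prod_def power2_eq_square)

lemma eucl_norm_nonneg: "eucl_norm x \<ge> 0"
  by (simp add: eucl_norm_L2_set)

lemma eucl_norm_triangle:
  assumes "x \<in> carrier_vec k" "y \<in> carrier_vec k"
  shows "eucl_norm (x + y) \<le> eucl_norm x + eucl_norm y"
proof -
  have "eucl_norm (x + y) = L2_set (\<lambda>i. x $ i + y $ i) {0..<k}"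
    using assms by (auto simp: eucl_norm_L2_set intro!: L2_set_cong)
  with L2_set_triangle_ineq[of "($) x" "($) y" "{0..<k}"] assms show ?thesis
    by (simp add: eucl_norm_L2_set)
qed

lemma eucl_norm_smult: "eucl_norm (t \<cdot>\<^sub>v x) = \<bar>t\<bar> * eucl_norm x"
proof -
  have "eucl_norm (t \<cdot>\<^sub>v x) = sqrt (t\<^sup>2 * (\<Sum>i = 0..<dim_vec x. (x $ i)\<^sup>2))"
    unfolding sum_distrib_left
    by (simp add: eucl_norm_def scalar_prod_def power2_eq_square mult_ac)
  then show ?thesis by (simp add: real_sqrt_mult eucl_norm_L2_set L2_set_def)
qed

text \<open>Supplies continuity of the new network's realization from that of the given one through
  the formula x + t g(x), with no induction over layers.\<close>

lemma cont_maps_add_smult: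
  assumes g: "g \<in> cont_maps d d"
  shows "restrict_dim d (\<lambda>x. x + t \<cdot>\<^sub>v g x) \<in> cont_maps d d"
  unfolding cont_maps_def
proof (intro CollectI conjI ballI allI impI)
  fix x :: "real vec" and e :: real assume x: "x \<in> carrier_vec d" and e: "e > 0"
  \<comment> \<open>Chosen so that \<bar>t\<bar> * e' stays below e / 2; the + 1 keeps the
    denominator positive when t = 0.\<close>
  define e' where "e' = e / 2 / (\<bar>t\<bar> + 1)"
  have "e' > 0" using e by (simp add: e'_def add_nonneg_pos)
  then obtain \<delta> where \<delta>: "\<delta> > 0"
    "\<And>y. y \<in> carrier_vec d \<Longrightarrow> eucl_norm (y - x) < \<delta> \<Longrightarrow> eucl_norm (g y - g x) < e'"
    using g x unfolding cont_maps_def by blast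
  show "\<exists>\<delta>>0. \<forall>y\<in>carrier_vec d. eucl_norm (y - x) < \<delta> \<longrightarrow>
    eucl_norm (restrict_dim d (\<lambda>x. x + t \<cdot>\<^sub>v g x) y - restrict_dim d (\<lambda>x. x + t \<cdot>\<^sub>v g x) x) < e"
  proof (intro exI[of _ "min \<delta> (e / 2)"] conjI ballI impI)
    fix y :: "real vec" assume y: "y \<in> carrier_vec d" and yx: "eucl_norm (y - x) < min \<delta> (e / 2)"
    have gx: "g x \<in> carrier_vec d" and gy: "g y \<in> carrier_vec d"
      using g x y by (auto simp: cont_maps_def)
    have "(y + t \<cdot>\<^sub>v g y) - (x + t \<cdot>\<^sub>v g x) = (y - x) + t \<cdot>\<^sub>v (g y - g x)"
      using x y gx gy by (intro eq_vecI) (auto simp: algebra_simps)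
    then have "eucl_norm ((y + t \<cdot>\<^sub>v g y) - (x + t \<cdot>\<^sub>v g x)) \<le>
        eucl_norm (y - x) + \<bar>t\<bar> * eucl_norm (g y - g x)"
      using eucl_norm_triangle[of "y - x" d "t \<cdot>\<^sub>v (g y - g x)"] x y gx gy
      by (simp add: eucl_norm_smult)
    also have "\<bar>t\<bar> * eucl_norm (g y - g x) \<le> (\<bar>t\<bar> + 1) * e'"
      using \<delta>(2)[OF y] yx by (intro mult_mono) (auto simp: eucl_norm_nonneg)
    also have "(\<bar>t\<bar> + 1) * e' = e / 2"
      unfolding e'_def by (simp add: add_nonneg_pos field_simps)
    finally show "eucl_norm (restrict_dim d (\<lambda>x. x + t \<cdot>\<^sub>v g x) y
        - restrict_dim d (\<lambda>x. x + t \<cdot>\<^sub>v g x) x) < e"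
      using yx x y by (simp add: restrict_dim_def)
  qed (use \<delta> e in auto)
qed (use g in \<open>auto simp: cont_maps_def restrict_dim_def\<close>)

section \<open>Chains of layers\<close>

text \<open>A recursive form of the width condition in \<open>ANN\<close>, suited to induction over
  the list of layers. Only output widths are required to be positive, so
  \<open>layer_chain_in_ANN\<close> asks separately for a positive input dimension.\<close>

fun layer_chain :: "nat \<Rightarrow> ann \<Rightarrow> nat \<Rightarrow> bool" where
  "layer_chain k [] m \<longleftrightarrow> k = m"
| "layer_chain k ((W, B) # \<Phi>) m \<longleftrightarrow>
     dim_col W = k \<and> dim_row W \<ge> 1 \<and> dim_vec B = dim_row W \<and> layer_chain (dim_row W) \<Phi> m"

lemma layer_chain_widths:
  assumes "layer_chain k \<Phi> m"
  shows "\<exists>l. l 0 = k \<and> (\<forall>j<length \<Phi>. l (Suc j) \<ge> 1 \<and>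
           \<Phi> ! j \<in> carrier_mat (l (Suc j)) (l j) \<times> carrier_vec (l (Suc j)))"
  using assms
proof (induction \<Phi> arbitrary: k)
  case Nil
  show ?case by (rule exI[of _ "\<lambda>_. k"]) simp
next
  case (Cons L \<Phi>)
  obtain W B where L: "L = (W, B)" by (cases L)
  have chain: "dim_col W = k" "dim_row W \<ge> 1" "dim_vec B = dim_row W" "layer_chain (dim_row W) \<Phi> m"
    using Cons.prems by (simp_all add: L)
  obtain l where l: "l 0 = dim_row W" "\<And>j. j < length \<Phi> \<Longrightarrow> l (Suc j) \<ge> 1"
    "\<And>j. j < length \<Phi> \<Longrightarrow> \<Phi> ! j \<in> carrier_mat (l (Suc j)) (l j) \<times> carrier_vec (l (Suc j))"
    using Cons.IH[OF chain(4)] by blast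
  have first: "L \<in> carrier_mat (l 0) k \<times> carrier_vec (l 0)"
    unfolding L using chain l(1) by (intro SigmaI carrier_matI carrier_vecI) simp_all
  \<comment> \<open>Prepending the input width k shifts the widths of the remaining layers by one
    index.\<close>
  show ?case
  proof (intro exI[of _ "case_nat k l"] conjI allI impI)
    fix j assume j: "j < length (L # \<Phi>)"
    show "case_nat k l (Suc j) \<ge> 1"
      using j l(1,2) chain(2) by (cases j) simp_all
    show "(L # \<Phi>) ! j \<in> carrier_mat (case_nat k l (Suc j)) (case_nat k l j)
        \<times> carrier_vec (case_nat k l (Suc j))"
    proof (cases j)
      case (Suc j')
      have "\<Phi> ! j' \<in> carrier_mat (l (Suc j')) (l j') \<times> carrier_vec (l (Suc j'))"
        using j Suc by (intro l(3)) simp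
      then show ?thesis by (simp only: Suc nth_Cons_Suc nat.case)
    qed (simp only: first nth_Cons_0 nat.case)
  qed simp
qed

lemma layer_chain_in_ANN:
  assumes "layer_chain k \<Phi> m" "k \<ge> 1" "\<Phi> \<noteq> []"
  shows "\<Phi> \<in> ANN"
proof -
  obtain l where l: "l 0 = k" "\<And>j. j < length \<Phi> \<Longrightarrow> l (Suc j) \<ge> 1"
    "\<And>j. j < length \<Phi> \<Longrightarrow> \<Phi> ! j \<in> carrier_mat (l (Suc j)) (l j) \<times> carrier_vec (l (Suc j))"
    using layer_chain_widths[OF assms(1)] by blast
  have "l j \<ge> 1" if "j \<le> length \<Phi>" for j
    using that l(1,2) assms(2) by (cases j) simp_all
  moreover have "length \<Phi> \<ge> 1" using assms(3) by (cases \<Phi>) simp_all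
  ultimately show ?thesis
    unfolding ANN_def using l(3) by blast
qed

lemma layer_chainI:
  assumes "\<And>j. j < length \<Phi> \<Longrightarrow> \<Phi> ! j \<in> carrier_mat (l (Suc j)) (l j) \<times> carrier_vec (l (Suc j))"
    and "\<And>j. j \<le> length \<Phi> \<Longrightarrow> (l j :: nat) \<ge> 1"
  shows "layer_chain (l 0) \<Phi> (l (length \<Phi>))"
  using assms
proof (induction \<Phi> arbitrary: l)
  case (Cons L \<Phi>)
  obtain W B where L: "L = (W, B)" by (cases L)
  have "layer_chain (l (Suc 0)) \<Phi> (l (Suc (length \<Phi>)))"
    using Cons.prems by (intro Cons.IH[of "\<lambda>j. l (Suc j)"]) force+
  then show ?case using Cons.prems(1)[of 0] Cons.prems(2)[of 1] by (auto simp: L)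
qed simp

lemma ANN_imp_layer_chain:
  assumes "\<Phi> \<in> ANN"
  obtains k m where "k \<ge> 1" "m \<ge> 1" "layer_chain k \<Phi> m" "\<Phi> \<noteq> []"
proof -
  from assms obtain l where l: "length \<Phi> \<ge> 1" "\<forall>k\<le>length \<Phi>. (l k :: nat) \<ge> 1"
    "\<forall>k<length \<Phi>. \<Phi> ! k \<in> carrier_mat (l (Suc k)) (l k) \<times> carrier_vec (l (Suc k))"
    unfolding ANN_def by auto
  then have "layer_chain (l 0) \<Phi> (l (length \<Phi>))" by (intro layer_chainI) auto
  moreover have "\<Phi> \<noteq> []" using l(1) by auto
  ultimately show ?thesis using that l(2) by blast
qed

lemma hd_ann_dims: "layer_chain k \<Phi> m \<Longrightarrow> \<Phi> \<noteq> [] \<Longrightarrow> hd (ann_dims \<Phi>) = k"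
  by (cases \<Phi>) (auto simp: ann_dims_def)

lemma ann_eval_carrier:
  "layer_chain k \<Phi> m \<Longrightarrow> x \<in> carrier_vec k \<Longrightarrow> ann_eval a \<Phi> x \<in> carrier_vec m"
proof (induction a \<Phi> x arbitrary: k rule: ann_eval.induct)
  case (3 a W B L \<Phi> x)
  have chain: "layer_chain (dim_row W) (L # \<Phi>) m" and "dim_vec B = dim_row W"
    using 3(2) by simp_all
  then have "map_vec a (W *\<^sub>v x + B) \<in> carrier_vec (dim_row W)" by (intro carrier_vecI) simp
  from "3.IH"[OF chain this] show ?case by simp
next
  case (2 a W B x)
  then show ?case by (intro carrier_vecI) simp
qed simp

lemma realization_layer_chain:
  assumes "layer_chain k \<Phi> m" "\<Phi> \<noteq> []"
  shows "realization a \<Phi> = restrict_dim k (ann_eval a \<Phi>)"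
  using hd_ann_dims[OF assms] by (simp add: realization_def)

text \<open>At the zero vector of dimension k' the realization has a value of positive dimension m',
  whereas off its own input space it takes the dummy value of dimension 0. Hence k = k', and then
  the dimension of the value at zero gives m = m'.\<close>

lemma layer_chain_dims_unique:
  assumes chain: "layer_chain k \<Phi> m" "\<Phi> \<noteq> []"
    and R: "realization a \<Phi> \<in> cont_maps k' m'" and "m' \<ge> 1"
  shows "k = k'" "m = m'"
proof -
  have *: "dim_vec (realization a \<Phi> (0\<^sub>v k')) = m'"
    using R zero_carrier_vec[of k'] unfolding cont_maps_def by (blast dest: carrier_vecD)
  show k: "k = k'"
  proof (rule ccontr)
    assume "k \<noteq> k'"
    then have "0\<^sub>v k' \<notin> (carrier_vec k :: real vec set)"
      by (metis carrier_vecD index_zero_vec(2))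
    with * \<open>m' \<ge> 1\<close> show False
      by (simp add: realization_layer_chain[OF chain] restrict_dim_def)
  qed
  have "dim_vec (ann_eval a \<Phi> (0\<^sub>v k)) = m"
    using ann_eval_carrier[OF chain(1) zero_carrier_vec] by (rule carrier_vecD)
  with * k show "m = m'" by (simp add: realization_layer_chain[OF chain] restrict_dim_def)
qed

section \<open>Adding a multiple of a network to the identity\<close>

lemma map_vec_append: "map_vec g (x @\<^sub>v y) = map_vec g x @\<^sub>v map_vec g y"
  by (intro eq_vecI) auto

text \<open>Serves the last layer of \<open>residual_tail\<close>, whose lower blocks have no rows
  and so contribute an empty vector.\<close>

lemma append_vec_dim_0: "dim_vec y = 0 \<Longrightarrow> x @\<^sub>v y = x"
  by (intro eq_vecI) auto

lemma smult_mat_mult_vec: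
  "dim_vec x = dim_col W \<Longrightarrow> (t \<cdot>\<^sub>m W) *\<^sub>v x = t \<cdot>\<^sub>v (W *\<^sub>v (x :: 'a :: comm_semiring_0 vec))"
  by (intro eq_vecI) (auto simp: scalar_prod_def sum_distrib_left mult.assoc)

lemma mult_block_diag_vec:
  fixes A D :: "'a :: comm_ring_1 mat"
  assumes A: "A \<in> carrier_mat k l" and D: "D \<in> carrier_mat m n"
    and x: "x \<in> carrier_vec l" and y: "y \<in> carrier_vec n"
  shows "four_block_mat A (0\<^sub>m k n) (0\<^sub>m m l) D *\<^sub>v (x @\<^sub>v y) = A *\<^sub>v x @\<^sub>v D *\<^sub>v y"
  by (subst four_block_mat_mult_vec[OF A _ _ D x y], insert A D x y, auto)

text \<open>A layer with q inputs and p outputs gains h of each. Each factor grows at most by 1 + h: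
  p + h is at most p (1 + h) as p \<ge> 1, and q + 1 + h is at most (q + 1) (1 + h).\<close>

lemma widened_layer_bound:
  fixes p q h :: nat
  assumes "p \<ge> 1"
  shows "(p + h) * (q + h + 1) \<le> (1 + h)\<^sup>2 * (p * (q + 1))"
proof -
  obtain p' where p: "p = p' + 1" using assms by (metis add.commute le_Suc_ex)
  have "(p + h) * (q + h + 1) \<le> (p * (1 + h)) * ((q + 1) * (1 + h))"
    by (intro mult_mono) (auto simp: p algebra_simps)
  then show ?thesis by (simp only: power2_eq_square mult_ac)
qed

text \<open>A network with one hidden layer of width h realizing the identity, split into an encoder
  \<open>V1\<close>, \<open>C1\<close> (followed by the activation) and an affine decoder
  \<open>V2\<close>, \<open>C2\<close>.\<close>

locale shallow_identity =
  fixes a :: "real \<Rightarrow> real" and d h :: nat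
    and V1 V2 :: "real mat" and C1 C2 :: "real vec"
  assumes V1: "V1 \<in> carrier_mat h d" and C1: "C1 \<in> carrier_vec h"
    and V2: "V2 \<in> carrier_mat d h" and C2: "C2 \<in> carrier_vec d"
    and d_pos: "d \<ge> 1"
    and identity: "x \<in> carrier_vec d \<Longrightarrow> V2 *\<^sub>v map_vec a (V1 *\<^sub>v x + C1) + C2 = x"
begin

text \<open>
  The input of \<open>residual_tail\<close> is \<open>y @\<^sub>v map_vec a (V1 *\<^sub>v x + C1)\<close>: the hidden state \<open>y\<close> of the
  given network together with an encoding of \<open>x\<close>, which every middle layer decodes and encodes anew.
\<close>

fun residual_tail :: "real \<Rightarrow> ann \<Rightarrow> ann" where
  "residual_tail t [] = []"
| "residual_tail t [(W, B)] =
     [(four_block_mat (t \<cdot>\<^sub>m W) V2 (0\<^sub>m 0 (dim_col W)) (0\<^sub>m 0 h), t \<cdot>\<^sub>v B + C2)]"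
| "residual_tail t ((W, B) # L # \<Phi>) =
     (four_block_mat W (0\<^sub>m (dim_row W) h) (0\<^sub>m h (dim_col W)) (V1 * V2),
      B @\<^sub>v (V1 *\<^sub>v C2 + C1)) # residual_tail t (L # \<Phi>)"

text \<open>A single layer has no hidden state in which to carry x, so the identity matrix is merged
  into its weights. Otherwise the first layer stacks the encoder below W, so that both read the same
  input x.\<close>

fun residual_net :: "real \<Rightarrow> ann \<Rightarrow> ann" where
  "residual_net t [] = []"
| "residual_net t [(W, B)] = [(1\<^sub>m d + t \<cdot>\<^sub>m W, t \<cdot>\<^sub>v B)]"
| "residual_net t ((W, B) # L # \<Phi>) = (W @\<^sub>r V1, B @\<^sub>v C1) # residual_tail t (L # \<Phi>)"

lemma dims [simp]:
  "dim_row V1 = h" "dim_col V1 = d" "dim_vec C1 = h"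
  "dim_row V2 = d" "dim_col V2 = h" "dim_vec C2 = d"
  using V1 C1 V2 C2 by auto

lemma layer_chain_residual_tail:
  "layer_chain k \<Phi> d \<Longrightarrow> \<Phi> \<noteq> [] \<Longrightarrow> layer_chain (k + h) (residual_tail t \<Phi>) d"
  by (induction t \<Phi> arbitrary: k rule: residual_tail.induct) auto

lemma layer_chain_residual_net:
  assumes "layer_chain d \<Phi> d" "\<Phi> \<noteq> []"
  shows "layer_chain d (residual_net t \<Phi>) d"
  using assms layer_chain_residual_tail[of _ _ t]
  by (cases "(t, \<Phi>)" rule: residual_net.cases) (auto simp: append_rows_def)

lemma residual_net_not_Nil: "\<Phi> \<noteq> [] \<Longrightarrow> residual_net t \<Phi> \<noteq> []"
  by (cases "(t, \<Phi>)" rule: residual_net.cases) auto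

text \<open>The encoding of x is invariant under the middle layers: if z encodes x, then V1 V2 z +
  (V1 C2 + C1) = V1 (V2 z + C2) + C1 = V1 x + C1, and the activation turns this back into z. The
  last layer decodes z to x and adds t times the output of \<Phi>.\<close>

lemma ann_eval_residual_tail:
  assumes "layer_chain k \<Phi> d" "\<Phi> \<noteq> []" "y \<in> carrier_vec k" "x \<in> carrier_vec d"
  shows "ann_eval a (residual_tail t \<Phi>) (y @\<^sub>v map_vec a (V1 *\<^sub>v x + C1)) = x + t \<cdot>\<^sub>v ann_eval a \<Phi> y"
  using assms
proof (induction t \<Phi> arbitrary: k y rule: residual_tail.induct)
  case (2 t W B)
  define z where "z = map_vec a (V1 *\<^sub>v x + C1)"
  have z: "z \<in> carrier_vec h" unfolding z_def by (intro carrier_vecI) simp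
  have W: "W \<in> carrier_mat d k" and B: "B \<in> carrier_vec d" using 2 by (auto intro!: carrier_vecI)
  \<comment> \<open>With no rows in the lower blocks, the block matrix merely puts t W and V2 side
    by side.\<close>
  have "four_block_mat (t \<cdot>\<^sub>m W) V2 (0\<^sub>m 0 k) (0\<^sub>m 0 h) *\<^sub>v (y @\<^sub>v z) = (t \<cdot>\<^sub>m W) *\<^sub>v y + V2 *\<^sub>v z"
    by (subst four_block_mat_mult_vec[of _ d k _ h _ 0])
       (use W V2 z 2(3) in \<open>auto intro!: append_vec_dim_0\<close>)
  also have "(t \<cdot>\<^sub>m W) *\<^sub>v y = t \<cdot>\<^sub>v (W *\<^sub>v y)"
    using W 2(3) by (intro smult_mat_mult_vec) auto
  finally have "four_block_mat (t \<cdot>\<^sub>m W) V2 (0\<^sub>m 0 k) (0\<^sub>m 0 h) *\<^sub>v (y @\<^sub>v z) + (t \<cdot>\<^sub>v B + C2)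
      = (V2 *\<^sub>v z + C2) + t \<cdot>\<^sub>v (W *\<^sub>v y + B)"
    using W B by (auto intro!: eq_vecI simp: algebra_simps)
  also have "V2 *\<^sub>v z + C2 = x" unfolding z_def by (rule identity[OF 2(4)])
  finally show ?case using 2(1) by (simp add: z_def)
next
  case (3 t W B L \<Phi>)
  define z where "z = map_vec a (V1 *\<^sub>v x + C1)"
  have z: "z \<in> carrier_vec h" unfolding z_def by (intro carrier_vecI) simp
  have W: "W \<in> carrier_mat (dim_row W) k" and B: "B \<in> carrier_vec (dim_row W)"
    and chain: "layer_chain (dim_row W) (L # \<Phi>) d"
    using 3 by (auto intro!: carrier_vecI)
  let ?M = "four_block_mat W (0\<^sub>m (dim_row W) h) (0\<^sub>m h k) (V1 * V2)"
  have "?M *\<^sub>v (y @\<^sub>v z) = W *\<^sub>v y @\<^sub>v (V1 * V2) *\<^sub>v z"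
    by (rule mult_block_diag_vec[OF W mult_carrier_mat[OF V1 V2] 3(4) z])
  also have "(V1 * V2) *\<^sub>v z = V1 *\<^sub>v (V2 *\<^sub>v z)"
    by (rule assoc_mult_mat_vec[OF V1 V2 z])
  also have "(W *\<^sub>v y @\<^sub>v V1 *\<^sub>v (V2 *\<^sub>v z)) + (B @\<^sub>v (V1 *\<^sub>v C2 + C1))
      = (W *\<^sub>v y + B) @\<^sub>v (V1 *\<^sub>v (V2 *\<^sub>v z) + (V1 *\<^sub>v C2 + C1))"
    by (rule append_vec_add[of _ "dim_row W" _ _ h]) (use B in \<open>auto intro: carrier_vecI\<close>)
  also have "V1 *\<^sub>v (V2 *\<^sub>v z) + (V1 *\<^sub>v C2 + C1) = V1 *\<^sub>v (V2 *\<^sub>v z + C2) + C1"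
    unfolding mult_add_distrib_mat_vec[OF V1 mult_mat_vec_carrier[OF V2 z] C2]
    by (rule assoc_add_vec[symmetric]) (auto intro: carrier_vecI)
  also have "V2 *\<^sub>v z + C2 = x" unfolding z_def by (rule identity[OF 3(5)])
  finally have *: "map_vec a (?M *\<^sub>v (y @\<^sub>v z) + (B @\<^sub>v (V1 *\<^sub>v C2 + C1)))
      = map_vec a (W *\<^sub>v y + B) @\<^sub>v z"
    by (simp add: map_vec_append z_def)
  \<comment> \<open>The tail must be seen to be nonempty before the recursive equation of
    \<open>ann_eval\<close> for a hidden layer applies.\<close>
  obtain M \<Phi>' where tail: "residual_tail t (L # \<Phi>) = M # \<Phi>'"
    by (cases "(t, L # \<Phi>)" rule: residual_tail.cases) auto
  have "ann_eval a (residual_tail t (L # \<Phi>)) (map_vec a (W *\<^sub>v y + B) @\<^sub>v z)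
      = x + t \<cdot>\<^sub>v ann_eval a (L # \<Phi>) (map_vec a (W *\<^sub>v y + B))"
    unfolding z_def using B by (intro 3(1)[OF chain]) (auto simp: 3(5) intro!: carrier_vecI)
  with * tail 3(2) show ?case by (simp add: z_def)
qed simp

text \<open>After activation, the stacked first layer yields exactly the pair of states from which
  \<open>ann_eval_residual_tail\<close> starts. For a single layer the claim is
  distributivity.\<close>

lemma ann_eval_residual_net:
  assumes "layer_chain d \<Phi> d" "\<Phi> \<noteq> []" "x \<in> carrier_vec d"
  shows "ann_eval a (residual_net t \<Phi>) x = x + t \<cdot>\<^sub>v ann_eval a \<Phi> x"
proof (cases "(t, \<Phi>)" rule: residual_net.cases)
  case (2 t' W B)
  have W: "W \<in> carrier_mat d d" and B: "B \<in> carrier_vec d"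
    using assms 2 by (auto intro!: carrier_vecI)
  have "(1\<^sub>m d + t \<cdot>\<^sub>m W) *\<^sub>v x = x + t \<cdot>\<^sub>v (W *\<^sub>v x)"
    using W assms(3) by (subst add_mult_distrib_mat_vec[of _ d d]) (auto simp: smult_mat_mult_vec)
  then show ?thesis using 2 W B assms(3) by (auto intro!: eq_vecI simp: algebra_simps)
next
  case (3 t' W B L \<Psi>)
  have W: "W \<in> carrier_mat (dim_row W) d" and B: "B \<in> carrier_vec (dim_row W)"
    and chain: "layer_chain (dim_row W) (L # \<Psi>) d"
    using assms 3 by (auto intro!: carrier_vecI)
  have "(W @\<^sub>r V1) *\<^sub>v x + (B @\<^sub>v C1) = (W *\<^sub>v x + B) @\<^sub>v (V1 *\<^sub>v x + C1)"
    unfolding mat_mult_append[OF W V1 assms(3)]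
    by (rule append_vec_add[of _ "dim_row W" _ _ h]) (use B C1 in \<open>auto intro: carrier_vecI\<close>)
  moreover obtain M \<Phi>' where tail: "residual_tail t (L # \<Psi>) = M # \<Phi>'"
    by (cases "(t, L # \<Psi>)" rule: residual_tail.cases) auto
  moreover have "ann_eval a (residual_tail t (L # \<Psi>))
      (map_vec a (W *\<^sub>v x + B) @\<^sub>v map_vec a (V1 *\<^sub>v x + C1))
      = x + t \<cdot>\<^sub>v ann_eval a (L # \<Psi>) (map_vec a (W *\<^sub>v x + B))"
    using B by (intro ann_eval_residual_tail[OF chain _ _ assms(3)]) (auto intro!: carrier_vecI)
  ultimately show ?thesis using 3 by (simp add: map_vec_append)
qed (use assms in auto)

section \<open>Parameter count of the residual network\<close>

lemma ann_params_residual_tail: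
  "layer_chain k \<Phi> d \<Longrightarrow> ann_params (residual_tail t \<Phi>) \<le> (1 + h)\<^sup>2 * ann_params \<Phi>"
proof (induction t \<Phi> arbitrary: k rule: residual_tail.induct)
  case (2 t W B)
  \<comment> \<open>The last layer gains inputs only; h fictitious outputs are added so that the
    common bound applies.\<close>
  have "d * (k + h + 1) \<le> (d + h) * (k + h + 1)" by (intro mult_le_mono) auto
  also have "\<dots> \<le> (1 + h)\<^sup>2 * (d * (k + 1))" by (rule widened_layer_bound[OF d_pos])
  finally show ?case using 2 by (simp add: ann_params_def)
next
  case (3 t W B L \<Phi>)
  then have "ann_params (residual_tail t (L # \<Phi>)) \<le> (1 + h)\<^sup>2 * ann_params (L # \<Phi>)" by auto
  moreover have "(dim_row W + h) * (k + h + 1) \<le> (1 + h)\<^sup>2 * (dim_row W * (k + 1))"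
    using 3 by (intro widened_layer_bound) auto
  ultimately show ?case using 3(2) by (simp add: ann_params_def distrib_left)
qed (simp add: ann_params_def)

lemma ann_params_residual_net:
  assumes "layer_chain d \<Phi> d"
  shows "ann_params (residual_net t \<Phi>) \<le> (1 + h)\<^sup>2 * ann_params \<Phi>"
proof (cases "(t, \<Phi>)" rule: residual_net.cases)
  case (2 t' W B)
  then show ?thesis using assms by (simp add: ann_params_def)
next
  case (3 t' W B L \<Psi>)
  then have "ann_params (residual_tail t (L # \<Psi>)) \<le> (1 + h)\<^sup>2 * ann_params (L # \<Psi>)"
    using assms by (intro ann_params_residual_tail) auto
  moreover have "(dim_row W + h) * (d + 1) \<le> (1 + h)\<^sup>2 * (dim_row W * (d + 1))"
  proof -
    \<comment> \<open>The first layer gains outputs only; here h fictitious inputs are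
      added.\<close>
    have "(dim_row W + h) * (d + 1) \<le> (dim_row W + h) * (d + h + 1)" by (intro mult_le_mono) auto
    also have "\<dots> \<le> (1 + h)\<^sup>2 * (dim_row W * (d + 1))"
      using assms 3 by (intro widened_layer_bound) auto
    finally show ?thesis .
  qed
  ultimately show ?thesis using 3 assms by (simp add: ann_params_def append_rows_def distrib_left)
qed (simp add: ann_params_def)

end

section \<open>From the given identity networks to the residual network\<close>

lemma shallow_identity_network:
  assumes ANN: "\<Psi> \<in> ANN" and R: "realization a \<Psi> = restrict_dim d (\<lambda>x. x)"
    and dims: "ann_dims \<Psi> = [d, h, d]"
  obtains V1 C1 V2 C2 where "shallow_identity a d h V1 V2 C1 C2"
proof -
  \<comment> \<open>A dimension list of length three forces exactly two layers.\<close>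
  obtain V1 C1 V2 C2 where \<Psi>: "\<Psi> = [(V1, C1), (V2, C2)]"
    using dims unfolding ann_dims_def by (auto simp: map_eq_Cons_conv)
  obtain k m where chain: "k \<ge> 1" "layer_chain k \<Psi> m"
    using ANN_imp_layer_chain[OF ANN] by metis
  have "V2 *\<^sub>v map_vec a (V1 *\<^sub>v x + C1) + C2 = x" if "x \<in> carrier_vec d" for x
    using fun_cong[OF R, of x] that dims by (simp add: realization_def restrict_dim_def \<Psi>)
  with chain dims have "shallow_identity a d h V1 V2 C1 C2"
    by unfold_locales (auto simp: \<Psi> ann_dims_def intro!: carrier_vecI)
  with that show ?thesis .
qed

lemma residual_network:
  assumes \<Psi>: "\<Psi> \<in> ANN" "realization a \<Psi> = restrict_dim d (\<lambda>x. x)" "ann_dims \<Psi> = [d, h, d]"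
    and d: "d \<ge> 1" and \<Phi>: "\<Phi> \<in> ANN" "realization a \<Phi> \<in> cont_maps d d"
  obtains \<Phi>' where "\<Phi>' \<in> ANN"
    and "realization a \<Phi>' = restrict_dim d (\<lambda>x. x + t \<cdot>\<^sub>v realization a \<Phi> x)"
    and "ann_params \<Phi>' \<le> (1 + h)\<^sup>2 * ann_params \<Phi>"
proof -
  obtain V1 C1 V2 C2 where "shallow_identity a d h V1 V2 C1 C2"
    using shallow_identity_network[OF \<Psi>] .
  then interpret shallow_identity a d h V1 V2 C1 C2 .
  obtain k m where "layer_chain k \<Phi> m" and nonempty: "\<Phi> \<noteq> []"
    using ANN_imp_layer_chain[OF \<Phi>(1)] by metis
  \<comment> \<open>The realization of \<Phi> maps dimension d to dimension d, which pins down the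
    outer widths of its layers.\<close>
  then have chain: "layer_chain d \<Phi> d"
    using layer_chain_dims_unique[OF _ nonempty \<Phi>(2) d] by metis
  note chain' = layer_chain_residual_net[OF chain nonempty, of t]
    residual_net_not_Nil[OF nonempty, of t]
  have "realization a (residual_net t \<Phi>) = restrict_dim d (\<lambda>x. x + t \<cdot>\<^sub>v realization a \<Phi> x)"
    unfolding realization_layer_chain[OF chain'] realization_layer_chain[OF chain nonempty]
    by (auto simp: restrict_dim_def ann_eval_residual_net[OF chain nonempty])
  then show ?thesis
    using that layer_chain_in_ANN[OF chain'(1) d chain'(2)] ann_params_residual_net[OF chain]
    by blast
qed

section \<open>The Euler step\<close>

theorem proposition3p20:
  fixes N :: nat and I :: "'i set" and \<dd> :: "'i \<Rightarrow> nat \<Rightarrow> nat"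
    and c T :: real and r \<iota> :: "nat \<Rightarrow> real"
    and H :: "'i \<Rightarrow> real \<Rightarrow> ereal"
    and \<G> \<H> :: "'i \<times> nat \<Rightarrow> real \<Rightarrow> ereal"
    and a w :: "real \<Rightarrow> real" and \<II> :: "'i \<Rightarrow> nat"
    and f :: "'i \<Rightarrow> real vec \<Rightarrow> real vec"
    and \<E> :: "nat \<Rightarrow> 'i \<Rightarrow> real vec \<Rightarrow> real vec"
    and \<ii> :: "nat \<Rightarrow> nat" and \<Psi> :: "nat \<Rightarrow> ann"
  assumes "N \<ge> 1" and "I \<noteq> {}" and "dim_mapping N I \<dd>"
    and "c \<ge> 0" and "T \<ge> 0"
    and "\<And>l. l \<in> {0..N} \<Longrightarrow> r l \<ge> 0"
    and "\<And>l. l \<in> {1..N} \<Longrightarrow> \<iota> l \<ge> 0"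
    and "\<And>i \<epsilon>. i \<in> I \<Longrightarrow> \<epsilon> \<in> {0<..1} \<Longrightarrow> H i \<epsilon> > 0"
    and "\<And>i n \<epsilon>. i \<in> I \<Longrightarrow> n \<ge> 1 \<Longrightarrow> \<epsilon> \<in> {0<..1} \<Longrightarrow> \<G> (i, n) \<epsilon> > 0"
    and "\<And>i n \<epsilon>. i \<in> I \<Longrightarrow> n \<ge> 1 \<Longrightarrow> \<epsilon> \<in> {0<..1} \<Longrightarrow> \<H> (i, n) \<epsilon> > 0"
    and "continuous_on UNIV a"
    and "\<And>i n \<epsilon>. i \<in> I \<Longrightarrow> n \<ge> 1 \<Longrightarrow> \<epsilon> \<in> {0<..1} \<Longrightarrow>
           \<G> (i, n) \<epsilon> = ereal (1 + c * T / real n)"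
    and "\<And>i n \<epsilon>. i \<in> I \<Longrightarrow> n \<ge> 1 \<Longrightarrow> \<epsilon> \<in> {0<..1} \<Longrightarrow>
           \<H> (i, n) \<epsilon> = H i (\<epsilon> / max T 1)"
    and "\<And>t. t \<ge> 0 \<Longrightarrow> w t \<ge> 0"
    and "\<And>i. i \<in> I \<Longrightarrow> \<II> i \<ge> 1"
    and "f \<in> approx_space a w (\<lambda>i \<epsilon>. ereal c) H N r I \<dd>"
    and "\<And>i. i \<in> I \<Longrightarrow> f i \<in> cont_maps (\<II> i) (\<II> i)"
    and "\<And>n. n \<ge> 1 \<Longrightarrow> function_family I (\<E> n)"
    and "\<And>n i. n \<ge> 1 \<Longrightarrow> i \<in> I \<Longrightarrow> \<E> n i \<in> cont_maps (\<II> i) (\<II> i)"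
    and "\<And>i. i \<in> I \<Longrightarrow> real (\<II> i) \<le> c * (\<Prod>l=1..N. real (\<dd> i l) powr \<iota> l)"
    and "\<And>i n x. i \<in> I \<Longrightarrow> n \<ge> 1 \<Longrightarrow> x \<in> carrier_vec (\<II> i) \<Longrightarrow>
           \<E> n i x = x + (T / real n) \<cdot>\<^sub>v f i x"
    and "\<And>i x y. i \<in> I \<Longrightarrow> x \<in> carrier_vec (\<II> i) \<Longrightarrow> y \<in> carrier_vec (\<II> i) \<Longrightarrow>
           eucl_norm (f i x - f i y) \<le> c * eucl_norm (x - y)"
    and "\<And>d. d \<ge> 1 \<Longrightarrow> \<ii> d \<ge> 1"
    and "\<And>d. d \<ge> 1 \<Longrightarrow> \<Psi> d \<in> ANN"
    and "\<And>d. d \<ge> 1 \<Longrightarrow> realization a (\<Psi> d) = restrict_dim d (\<lambda>x. x)"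
    and "\<And>d. d \<ge> 1 \<Longrightarrow> ann_dims (\<Psi> d) = [d, \<ii> d, d]"
    and "\<And>d. d \<ge> 1 \<Longrightarrow> real (\<ii> d) \<le> c * real d"
  shows "(\<lambda>(i, n). \<E> n i) \<in>
    approx_space a w \<G> \<H> (N + 1)
      (\<lambda>l. if l = 0 then r 0 else if l \<le> N then r l + 4 * \<iota> l else 0)
      (I \<times> {1..}) (dim_tensor_id N \<dd>)"
proof -
  \<comment> \<open>\<Phi> is taken with accuracy \<epsilon> / M: since T / n \<le> M, scaling by T
    / n brings the error back to at most \<epsilon>, and M \<ge> 1 keeps \<epsilon> / M in the
    admissible range.\<close>
  define M where "M = max T 1"
  have M: "M \<ge> 1" "T \<le> M" by (auto simp: M_def)
  \<comment> \<open>The identity network in dimension 1 has between 1 and c hidden neurons.\<close>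
  have c1: "c \<ge> 1" using assms(23)[of 1] assms(27)[of 1] by simp
  from assms(16) obtain K where K: "\<forall>i\<in>I. \<forall>\<epsilon>\<in>{0<..1}. \<exists>\<Phi>\<in>ANN. \<exists>m\<ge>1. \<exists>n\<ge>1. \<forall>x\<in>carrier_vec m.
      {f i, realization a \<Phi>} \<subseteq> cont_maps m n \<and>
      real (ann_params \<Phi>) \<le> K * \<epsilon> powr (- r 0) * (\<Prod>l=1..N. real (\<dd> i l) powr r l) \<and>
      w (eucl_norm x) * eucl_norm (f i x - realization a \<Phi> x) \<le> \<epsilon> \<and>
      ereal (eucl_norm (realization a \<Phi> x)) \<le> ereal c * (H i \<epsilon> + ereal (eucl_norm x))"
    unfolding approx_space_def by blast
  let ?r = "\<lambda>l. if l = 0 then r 0 else if l \<le> N then r l + 4 * \<iota> l else 0"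
  \<comment> \<open>The factor 4 c^4 pays for the widened layers, and the power of M for asking
    accuracy \<epsilon> / M instead of \<epsilon>.\<close>
  let ?K = "4 * c ^ 4 * K * M powr r 0"
  have main: "\<exists>\<Phi>\<in>ANN. \<exists>m\<ge>1. \<exists>n'\<ge>1. \<forall>x\<in>carrier_vec m.
      {\<E> n i, realization a \<Phi>} \<subseteq> cont_maps m n' \<and>
      real (ann_params \<Phi>) \<le> ?K * \<epsilon> powr (- ?r 0) *
        (\<Prod>l=1..N + 1. real (dim_tensor_id N \<dd> (i, n) l) powr ?r l) \<and>
      w (eucl_norm x) * eucl_norm (\<E> n i x - realization a \<Phi> x) \<le> \<epsilon> \<and>
      ereal (eucl_norm (realization a \<Phi> x)) \<le> \<G> (i, n) \<epsilon> * (\<H> (i, n) \<epsilon> + ereal (eucl_norm x))"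
    if i: "i \<in> I" and n: "n \<ge> 1" and \<epsilon>: "\<epsilon> \<in> {0<..1}" for i n \<epsilon>
  proof -
    define d where "d = \<II> i"
    define t where "t = T / real n"
    have d1: "d \<ge> 1" using assms(15)[OF i] by (simp add: d_def)
    have "T / real n \<le> T / 1" using n assms(5) by (intro divide_left_mono) auto
    then have t: "t \<ge> 0" "t \<le> M" using assms(5) M n by (auto simp: t_def)
    have fi: "f i \<in> cont_maps d d" using assms(17)[OF i] by (simp add: d_def)
    have \<epsilon>M: "\<epsilon> / M \<in> {0<..1}" using \<epsilon> M by (auto simp: field_simps)
    obtain \<Phi> m m' where \<Phi>: "\<Phi> \<in> ANN" and m: "m \<ge> 1" "m' \<ge> 1" and \<Phi>_props: "\<forall>x\<in>carrier_vec m.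
      {f i, realization a \<Phi>} \<subseteq> cont_maps m m' \<and>
      real (ann_params \<Phi>) \<le> K * (\<epsilon> / M) powr (- r 0) * (\<Prod>l=1..N. real (\<dd> i l) powr r l) \<and>
      w (eucl_norm x) * eucl_norm (f i x - realization a \<Phi> x) \<le> \<epsilon> / M \<and>
      ereal (eucl_norm (realization a \<Phi> x)) \<le> ereal c * (H i (\<epsilon> / M) + ereal (eucl_norm x))"
      using K i \<epsilon>M by blast
    \<comment> \<open>The dimensions and the parameter bound do not depend on x but stand under its
      quantifier; the zero vector extracts them.\<close>
    have "f i \<in> cont_maps m m'" using bspec[OF \<Phi>_props zero_carrier_vec] by simp
    then have mm: "m = d" "m' = d" using cont_maps_dims_unique[OF _ fi] m d1 by auto
    have R: "realization a \<Phi> \<in> cont_maps d d"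
      and params: "real (ann_params \<Phi>) \<le>
        K * (\<epsilon> / M) powr (- r 0) * (\<Prod>l=1..N. real (\<dd> i l) powr r l)"
      using bspec[OF \<Phi>_props zero_carrier_vec] mm by auto
    obtain \<Phi>' where \<Phi>': "\<Phi>' \<in> ANN"
      and R': "realization a \<Phi>' = restrict_dim d (\<lambda>x. x + t \<cdot>\<^sub>v realization a \<Phi> x)"
      and params': "ann_params \<Phi>' \<le> (1 + \<ii> d)\<^sup>2 * ann_params \<Phi>"
      using residual_network[OF assms(24,25,26)[OF d1] d1 \<Phi> R] by blast
    have Ei: "\<E> n i \<in> cont_maps d d" using assms(19)[OF n i] by (simp add: d_def)
    have dd: "real (\<dd> i l) \<ge> 1" if "l \<in> {1..N}" for l
      using assms(3) i that by (auto simp: dim_mapping_def)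
    have R'_cont: "realization a \<Phi>' \<in> cont_maps d d"
      unfolding R' by (rule cont_maps_add_smult[OF R])

    define P where "P = (\<Prod>l=1..N. real (\<dd> i l) powr \<iota> l)"
    define Q where "Q = (\<Prod>l=1..N. real (\<dd> i l) powr r l)"
    have P1: "P \<ge> 1" unfolding P_def
      by (intro prod_ge_1 ge_one_powr_ge_zero) (use dd assms(7) in auto)
    have dP: "real d \<le> c * P" using assms(20)[OF i] by (simp add: d_def P_def)
    have "real (1 + \<ii> d) \<le> 2 * (c * real d)"
    proof -
      \<comment> \<open>As 1 \<le> c d, the summand 1 in 1 + \<ii> d is absorbed by doubling c
        d.\<close>
      have "1 * 1 \<le> c * real d" using c1 d1 by (intro mult_mono) auto
      with assms(27)[OF d1] show ?thesis by simp
    qed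
    also have "\<dots> \<le> 2 * (c * (c * P))" using dP c1 by (intro mult_left_mono) auto
    finally have "(real (1 + \<ii> d))\<^sup>2 \<le> (2 * (c * (c * P)))\<^sup>2" by (intro power_mono) auto
    also have "\<dots> = 4 * c ^ 4 * P ^ 2" by (simp add: power2_eq_square power4_eq_xxxx)
    \<comment> \<open>The width costs only P^2; as P \<ge> 1 this is relaxed to P^4, which matches
      the exponents 4 \<iota> of the claim.\<close>
    also have "\<dots> \<le> 4 * c ^ 4 * P ^ 4"
      using P1 c1 by (intro mult_left_mono power_increasing) auto
    finally have width: "(real (1 + \<ii> d))\<^sup>2 \<le> 4 * c ^ 4 * P ^ 4" .
    have "real (ann_params \<Phi>') \<le> real ((1 + \<ii> d)\<^sup>2 * ann_params \<Phi>)"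
      using params' by (rule of_nat_mono)
    also have "\<dots> = (real (1 + \<ii> d))\<^sup>2 * real (ann_params \<Phi>)" by simp
    also have "\<dots> \<le> (4 * c ^ 4 * P ^ 4) * (K * (\<epsilon> / M) powr (- r 0) * Q)"
      using width params c1 P1 by (intro mult_mono) (auto simp: Q_def)
    also have "(\<epsilon> / M) powr (- r 0) = M powr r 0 * \<epsilon> powr (- r 0)"
      using \<epsilon> M by (simp add: powr_divide powr_minus field_simps)
    also have "(4 * c ^ 4 * P ^ 4) * (K * (M powr r 0 * \<epsilon> powr (- r 0)) * Q)
        = ?K * \<epsilon> powr (- r 0) * (Q * P ^ 4)" by simp
    also have "Q * P ^ 4 = (\<Prod>l=1..N. real (\<dd> i l) powr (r l + 4 * \<iota> l))"
    proof -
      have "real (\<dd> i l) powr (r l + 4 * \<iota> l) = real (\<dd> i l) powr r l * (real (\<dd> i l) powr \<iota> l) ^ 4"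
        if "l \<in> {1..N}" for l
        using dd[OF that] by (simp add: powr_add powr_power mult.commute)
      then show ?thesis
        by (simp add: Q_def P_def prod.distrib prod_power_distrib)
    qed
    \<comment> \<open>The additional factor is n powr 0, which equals 1 because n \<ge> 1
      (\<open>0 powr 0\<close> would be 0).\<close>
    also have "\<dots> = (\<Prod>l=1..N + 1. real (dim_tensor_id N \<dd> (i, n) l) powr ?r l)"
      using n by (auto simp: dim_tensor_id_def intro!: prod.cong)
    finally have params_bound: "real (ann_params \<Phi>') \<le> ?K * \<epsilon> powr (- ?r 0) *
        (\<Prod>l=1..N + 1. real (dim_tensor_id N \<dd> (i, n) l) powr ?r l)" by simp

    have "w (eucl_norm x) * eucl_norm (\<E> n i x - realization a \<Phi>' x) \<le> \<epsilon>"
      and "ereal (eucl_norm (realization a \<Phi>' x)) \<le> \<G> (i, n) \<epsilon> * (\<H> (i, n) \<epsilon> + ereal (eucl_norm x))"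
      if x: "x \<in> carrier_vec d" for x
    proof -
      let ?g = "realization a \<Phi> x"
      have gx: "?g \<in> carrier_vec d" and fx: "f i x \<in> carrier_vec d"
        using R fi x by (auto simp: cont_maps_def)
      have R'x: "realization a \<Phi>' x = x + t \<cdot>\<^sub>v ?g" using x by (simp add: R' restrict_dim_def)
      have err: "w (eucl_norm x) * eucl_norm (f i x - ?g) \<le> \<epsilon> / M"
        and grow: "ereal (eucl_norm ?g) \<le> ereal c * (H i (\<epsilon> / M) + ereal (eucl_norm x))"
        using \<Phi>_props x mm by auto
      \<comment> \<open>The summand x is reproduced exactly and cancels, leaving t times the error
        of \<Phi>.\<close>
      have "\<E> n i x - realization a \<Phi>' x = t \<cdot>\<^sub>v (f i x - ?g)"
        using x gx fx assms(21)[OF i n, of x] R'x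
        by (intro eq_vecI) (auto simp: d_def t_def algebra_simps)
      then have "w (eucl_norm x) * eucl_norm (\<E> n i x - realization a \<Phi>' x)
          = t * (w (eucl_norm x) * eucl_norm (f i x - ?g))"
        using t by (simp add: eucl_norm_smult)
      also have "\<dots> \<le> M * (\<epsilon> / M)"
        using err t M assms(14)[OF eucl_norm_nonneg] by (intro mult_mono) (auto simp: eucl_norm_nonneg)
      finally show "w (eucl_norm x) * eucl_norm (\<E> n i x - realization a \<Phi>' x) \<le> \<epsilon>"
        using M by simp
      have GH: "\<G> (i, n) \<epsilon> = ereal (1 + c * t)" "\<H> (i, n) \<epsilon> = H i (\<epsilon> / M)"
        using assms(12,13)[OF i n \<epsilon>] by (auto simp: t_def M_def)
      have norm: "eucl_norm (realization a \<Phi>' x) \<le> eucl_norm x + t * eucl_norm ?g"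
        using eucl_norm_triangle[of x d "t \<cdot>\<^sub>v ?g"] x gx t by (simp add: R'x eucl_norm_smult)
      have ct: "1 + c * t > 0" using c1 t by (simp add: add_pos_nonneg)
      \<comment> \<open>For finite h = H i (\<epsilon> / M), the norm is at most |x| + c t (h +
        |x|), and h > 0 allows the first |x| to be enlarged to h + |x|. For an infinite value the
        right-hand side is infinite, since 1 + c t > 0.\<close>
      show "ereal (eucl_norm (realization a \<Phi>' x))
          \<le> \<G> (i, n) \<epsilon> * (\<H> (i, n) \<epsilon> + ereal (eucl_norm x))"
      proof (cases "H i (\<epsilon> / M)")
        case (real h)
        have h: "h > 0" using assms(8)[OF i \<epsilon>M] real by simp
        have "t * eucl_norm ?g \<le> t * (c * (h + eucl_norm x))"
          using grow real t by (intro mult_left_mono) auto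
        with norm h have "eucl_norm (realization a \<Phi>' x) \<le> (1 + c * t) * (h + eucl_norm x)"
          by (simp add: algebra_simps)
        then show ?thesis by (simp add: GH real)
      next
        case PInf
        with ct show ?thesis by (simp add: GH)
      next
        case MInf
        with assms(8)[OF i \<epsilon>M] show ?thesis by simp
      qed
    qed
    with \<Phi>' d1 Ei R'_cont params_bound show ?thesis by blast
  qed
  have "function_family (I \<times> {1..}) (\<lambda>(i, n). \<E> n i)"
    using assms(15,19) unfolding function_family_def by fastforce
  then show ?thesis
    unfolding approx_space_def by (intro CollectI conjI exI[of _ ?K]) (use main in auto)
qed

end
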